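(* Let $n\ge 1$. There is a one-to-one correspondence (bijection) between the regions of the type $C$ Catalan arrangement $\mathcal{C}_{\{-1,0,1\}}(n)$ in $\mathbb{R}^n$ and the set $D^{(1)}(2n)$ of symmetric annotated $1$-sketches of size $2n$.
   Context: The type $C$ Catalan arrangement $\mathcal{C}_{\{-1,0,1\}}(n)$ in $\mathbb{R}^n$ is the set of hyperplanes $x_i-x_j=s$, $x_i+x_j=s$ (for $1\le i<j\le n$) and $2x_i=s$ (for $1\le i\le n$), for all $s\in\{-1,0,1\}$. Its regions are the connected components of $\mathbb{R}^n\setminus\bigcup_{H\in\mathcal{C}_{\{-1,0,1\}}(n)}H$. Let $I_n=\{-n,\dots,-1,1,\dots,n\}$ and let $\mathcal{A}_{2n}=\{\alpha_i^{(0)},\alpha_i^{(1)} : i\in I_n\}$ be an alphabet of $4n$ distinct letters. A symmetric annotated $1$-sketch of size $2n$ is a word $\omega=w_1\cdots w_{4n}$ such that for all $i,j\in I_n$: (i) $\{w_1,\dots,w_{4n}\}=\mathcal{A}_{2n}$ (so each letter appears exactly once); (ii) $\alpha_i^{(0)}$ appears before $\alpha_i^{(1)}$; (iii) if $\alpha_i^{(0)}$ appears before $\alpha_j^{(0)}$ then $\alpha_i^{(1)}$ appears before $\alpha_j^{(1)}$; (iv) for each $s\in\{0,1\}$, if $\alpha_i^{(0)}$ appears before $\alpha_j^{(s)}$ then $\alpha_{-j}^{(0)}$ appears before $\alpha_{-i}^{(s)}$. $D^{(1)}(2n)$ is the set of all symmetric annotated $1$-sketches of size $2n$. *)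

theory Defs
  imports "HOL-Analysis.Analysis"
begin

text \<open>
  Points of $\mathbb{R}^n$ are the extensional functions on the index set \<open>{1..n}\<close>, so that
  coordinates are numbered from 1; the topology is the product topology, i.e. the usual one.
\<close>

abbreviation Rn :: "nat \<Rightarrow> (nat \<Rightarrow> real) topology" where
  "Rn n \<equiv> product_topology (\<lambda>_. euclideanreal) {1..n}"

definition catalan_C :: "nat \<Rightarrow> (nat \<Rightarrow> real) set set" where
  "catalan_C n =
     {{x \<in> topspace (Rn n). x i - x j = s} | i j s. 1 \<le> i \<and> i < j \<and> j \<le> n \<and> s \<in> {-1, 0, 1}} \<union>
     {{x \<in> topspace (Rn n). x i + x j = s} | i j s. 1 \<le> i \<and> i < j \<and> j \<le> n \<and> s \<in> {-1, 0, 1}} \<union>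
     {{x \<in> topspace (Rn n). 2 * x i = s} | i s. 1 \<le> i \<and> i \<le> n \<and> s \<in> {-1, 0, 1}}"

definition regions :: "nat \<Rightarrow> (nat \<Rightarrow> real) set set \<Rightarrow> (nat \<Rightarrow> real) set set" where
  "regions n \<H> = connected_components_of (subtopology (Rn n) (topspace (Rn n) - \<Union>\<H>))"

definition signed_indices :: "nat \<Rightarrow> int set" where
  "signed_indices n = {- int n..int n} - {0}"

text \<open>\<open>Alpha i s\<close> is the letter $\alpha_i^{(s)}$.\<close>

datatype letter = Alpha int nat

definition alphabet :: "nat \<Rightarrow> letter set" where
  "alphabet n = {Alpha i s | i s. i \<in> signed_indices n \<and> s \<in> {0, 1}}"

definition appears_before :: "'a list \<Rightarrow> 'a \<Rightarrow> 'a \<Rightarrow> bool" where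
  "appears_before w a b \<longleftrightarrow> (\<exists>p q. p < q \<and> q < length w \<and> w ! p = a \<and> w ! q = b)"

text \<open>
  Having length $4n$, a word whose set of letters is the $4n$-element alphabet contains each
  letter exactly once.
\<close>

definition symmetric_annotated_1_sketches :: "nat \<Rightarrow> letter list set" where
  "symmetric_annotated_1_sketches n =
     {w. length w = 4 * n \<and> set w = alphabet n \<and>
         (\<forall>i\<in>signed_indices n. appears_before w (Alpha i 0) (Alpha i 1)) \<and>
         (\<forall>i\<in>signed_indices n. \<forall>j\<in>signed_indices n.
            appears_before w (Alpha i 0) (Alpha j 0) \<longrightarrow>
            appears_before w (Alpha i 1) (Alpha j 1)) \<and>
         (\<forall>i\<in>signed_indices n. \<forall>j\<in>signed_indices n. \<forall>s\<in>{0, 1}.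
            appears_before w (Alpha i 0) (Alpha j s) \<longrightarrow>
            appears_before w (Alpha (- j) 0) (Alpha (- i) s))}"

end

theory Submission
  imports Defs
begin

text \<open>
  Put \<open>x\<^bsub>-i\<^esub> = -x\<^sub>i\<close> and read the letter $\alpha_i^{(s)}$ as the number \<open>x\<^sub>i + s\<close>.
  A point lies off the arrangement iff these \<open>4n\<close> numbers are distinct, and sorting them gives a
  sketch. By continuity the sketch is constant on a region, and by convexity the points with a
  given sketch lie in one region. To realise a sketch, choose numbers \<open>y\<^sub>i\<close> greedily in the order
  in which the letters $\alpha_i^{(0)}$ occur; condition (iv) makes the order of the letters
  survive the symmetrisation \<open>x\<^sub>i = (y\<^sub>i - y\<^bsub>-i\<^esub>) / 2\<close>.
\<close>

subsection \<open>Sorting a finite set by an injective key\<close>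

text \<open>The letters carry no order of their own, so the values of \<open>f\<close> are sorted
  and pulled back along the inverse of \<open>f\<close>. This gives the intended list when
  \<open>f\<close> is injective on a finite \<open>A\<close>.\<close>

definition key_sorted_list :: "('a \<Rightarrow> 'b::linorder) \<Rightarrow> 'a set \<Rightarrow> 'a list" where
  "key_sorted_list f A = map (the_inv_into A f) (sorted_list_of_set (f ` A))"

lemma key_sorted_list:
  assumes "finite A" "inj_on f A"
  shows map_key_sorted_list: "map f (key_sorted_list f A) = sorted_list_of_set (f ` A)"
    and set_key_sorted_list: "set (key_sorted_list f A) = A"
    and length_key_sorted_list: "length (key_sorted_list f A) = card A"
proof -
  show "map f (key_sorted_list f A) = sorted_list_of_set (f ` A)"
    unfolding key_sorted_list_def map_map
    by (rule map_idI) (use assms in \<open>auto simp: f_the_inv_into_f\<close>)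
  show "set (key_sorted_list f A) = A"
    using assms by (simp add: key_sorted_list_def image_image the_inv_into_f_f)
  show "length (key_sorted_list f A) = card A"
    using assms by (simp add: key_sorted_list_def card_image)
qed

lemma appears_before_key_sorted:
  assumes "sorted_wrt (<) (map f w)" "a \<in> set w" "b \<in> set w"
  shows "appears_before w a b \<longleftrightarrow> f a < (f b :: 'b::linorder)"
proof -
  have mono: "f (w ! p) < f (w ! q)" if "p < q" "q < length w" for p q
    using sorted_wrt_nth_less[OF assms(1), of p q] that by simp
  show ?thesis
  proof
    assume "appears_before w a b"
    then show "f a < f b" unfolding appears_before_def using mono by blast
  next
    assume less: "f a < f b"
    obtain p q where "p < length w" "w ! p = a" "q < length w" "w ! q = b"
      using assms(2,3) by (metis in_set_conv_nth)
    moreover from this have "p < q"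
      using less mono[of q p] by (metis less_asym less_irrefl linorder_neqE_nat)
    ultimately show "appears_before w a b" unfolding appears_before_def by blast
  qed
qed

lemma sorted_wrt_key_sorted_list:
  assumes "finite A" "inj_on f A"
  shows "sorted_wrt (<) (map f (key_sorted_list f A))"
  using assms by (simp add: map_key_sorted_list)

text \<open>A strictly increasing list of values is determined by its set, and injectivity of the
  key carries this back to letters. This is how a given word is recognised as the sketch of a
  point.\<close>

lemma key_sorted_list_unique:
  assumes "sorted_wrt (<) (map f w)"
  shows "key_sorted_list f (set w) = w" and "inj_on f (set w)"
proof -
  have "distinct (map f w)" using assms by (simp add: strict_sorted_iff)
  then show inj: "inj_on f (set w)" by (simp add: distinct_map)
  have "map f (key_sorted_list f (set w)) = map f w"
    using assms inj sorted_list_of_set.idem_if_sorted_distinct[of "map f w"]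
    by (simp add: map_key_sorted_list strict_sorted_iff)
  then show "key_sorted_list f (set w) = w"
    using inj by (simp add: inj_on_map_eq_map set_key_sorted_list)
qed

subsection \<open>Realising the order of intervals of unit length\<close>

text \<open>For two nonempty sets, density of the reals gives a point between \<open>Max A\<close>
  and \<open>Min B\<close>. If one set is empty, a point beyond the extremum of the other will
  do.\<close>

lemma ex_real_between_finite:
  assumes "finite A" "finite B" "\<And>a b. a \<in> A \<Longrightarrow> b \<in> B \<Longrightarrow> a < (b::real)"
  shows "\<exists>z. (\<forall>a\<in>A. a < z) \<and> (\<forall>b\<in>B. z < b)"
proof -
  consider "A = {}" | "B = {}" | "A \<noteq> {}" "B \<noteq> {}" by blast
  then show ?thesis
  proof cases
    case 1
    have "Min B - 1 < b" if "b \<in> B" for b using Min_le[OF assms(2) that] by linarith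
    then show ?thesis using 1 by blast
  next
    case 2
    have "a < Max A + 1" if "a \<in> A" for a using Max_ge[OF assms(1) that] by linarith
    then show ?thesis using 2 by blast
  next
    case 3
    then have "Max A < Min B" using assms by simp
    then obtain z where "Max A < z" "z < Min B" using dense by blast
    then show ?thesis using 3 assms by auto
  qed
qed

text \<open>\<open>P i\<close> and \<open>Q i\<close> are the positions of the left and right end points of the \<open>i\<close>-th interval.\<close>

lemma ex_unit_interval_representation:
  fixes P Q :: "'a \<Rightarrow> nat"
  assumes "finite I"
    and "inj_on P I"
    and "\<And>i. i \<in> I \<Longrightarrow> P i < Q i"
    and "\<And>i j. i \<in> I \<Longrightarrow> j \<in> I \<Longrightarrow> P i < P j \<Longrightarrow> Q i < Q j"
  shows "\<exists>y::'a \<Rightarrow> real. \<forall>i\<in>I. \<forall>j\<in>I. (P i < P j \<longrightarrow> y i < y j) \<and>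
    (P i < Q j \<longrightarrow> y i < y j + 1) \<and> (Q j < P i \<longrightarrow> y j + 1 < y i)"
  using assms
\<comment> \<open>Intervals are placed by increasing left end point: no interval placed before
  \<open>k\<close> starts after it.\<close>
proof (induction I rule: finite_ranking_induct[where f = P])
  case empty
  then show ?case by simp
next
  case (insert k S)
  have PQ: "P i < Q i" if "i \<in> insert k S" for i using insert.prems(2) that .
  have mono: "Q i < Q j" if "i \<in> insert k S" "j \<in> insert k S" "P i < P j" for i j
    using insert.prems(3) that .
  show ?case
  \<comment> \<open>The ranking induction does not provide that \<open>k\<close> is new.\<close>
  proof (cases "k \<in> S")
    case True
    then show ?thesis using insert.IH insert.prems by (simp add: insert_absorb)
  next
    case False
    obtain y where y: "\<And>i j. i \<in> S \<Longrightarrow> j \<in> S \<Longrightarrow> P i < P j \<Longrightarrow> y i < (y j :: real)"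
        "\<And>i j. i \<in> S \<Longrightarrow> j \<in> S \<Longrightarrow> P i < Q j \<Longrightarrow> y i < y j + 1"
        "\<And>i j. i \<in> S \<Longrightarrow> j \<in> S \<Longrightarrow> Q j < P i \<Longrightarrow> y j + 1 < y i"
    proof -
      have "inj_on P S" using insert.prems(1) by (rule inj_on_subset) blast
      from insert.IH[OF this PQ mono] show thesis using that by blast
    qed
    have less_k: "P i < P k" if "i \<in> S" for i
      using insert.hyps(2)[OF that] insert.prems(1) False that
      by (metis inj_onD insertCI le_neq_implies_less)
    \<comment> \<open>The left end point of \<open>k\<close> must exceed all values in
      \<open>A\<close>, which are the earlier left end points and the right end points preceding
      \<open>P k\<close>. It must stay below those in \<open>B\<close>, the right end points
      following \<open>P k\<close>.\<close>
    define A where "A = y ` S \<union> (\<lambda>j. y j + 1) ` {j \<in> S. Q j < P k}"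
    define B where "B = (\<lambda>j. y j + 1) ` {j \<in> S. P k < Q j}"
    have "a < b" if "a \<in> A" "b \<in> B" for a b
    proof -
      obtain j where j: "j \<in> S" "P k < Q j" "b = y j + 1" using \<open>b \<in> B\<close> unfolding B_def by auto
      consider i where "i \<in> S" "a = y i" | i where "i \<in> S" "Q i < P k" "a = y i + 1"
        using \<open>a \<in> A\<close> unfolding A_def by auto
      then show ?thesis
      proof cases
        case 1
        then show ?thesis using j less_k[of i] y(2)[of i j] by simp
      next
        case 2
        \<comment> \<open>Here \<open>Q i < P k < Q j\<close>, so monotonicity forces interval
          \<open>i\<close> to start before interval \<open>j\<close>; adding 1 to both left end
          points keeps the order.\<close>
        have "\<not> P j < P i" using mono[of j i] 2 j by auto
        moreover have "i \<noteq> j" using 2 j by auto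
        ultimately have "P i < P j"
          using insert.prems(1) 2 j by (metis inj_onD insertCI linorder_neqE_nat)
        then show ?thesis using y(1) 2 j by simp
      qed
    qed
    moreover have "finite A" "finite B" using insert.hyps(1) unfolding A_def B_def by auto
    ultimately obtain z where z: "\<forall>a\<in>A. a < z" "\<forall>b\<in>B. z < b"
      using ex_real_between_finite by metis
    have zy: "y i < z" if "i \<in> S" for i using z(1) that unfolding A_def by auto
    have zl: "y j + 1 < z" if "j \<in> S" "Q j < P k" for j using z(1) that unfolding A_def by auto
    have zu: "z < y j + 1" if "j \<in> S" "P k < Q j" for j using z(2) that unfolding B_def by auto
    \<comment> \<open>As \<open>k\<close> starts last, its right end point follows every left end
      point, so no interval is required to start after \<open>k\<close> ends.\<close>
    have Qk: "\<not> Q k < P i" if "i \<in> insert k S" for i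
      using less_k PQ[of k] that by (metis insertE insertI1 less_trans less_asym)
    have Pk: "\<not> P k < P i" if "i \<in> insert k S" for i
      using less_k that by (metis insertE less_asym less_irrefl)
    show ?thesis
    proof (intro exI[of _ "y(k := z)"] ballI)
      fix i j assume ij: "i \<in> insert k S" "j \<in> insert k S"
      show "(P i < P j \<longrightarrow> (y(k := z)) i < (y(k := z)) j) \<and>
        (P i < Q j \<longrightarrow> (y(k := z)) i < (y(k := z)) j + 1) \<and>
        (Q j < P i \<longrightarrow> (y(k := z)) j + 1 < (y(k := z)) i)"
      proof (cases "i = k")
        case True
        then show ?thesis using ij zl zu Pk Qk by (cases "j = k") auto
      next
        case False
        then have i: "i \<in> S" using ij by auto
        show ?thesis
        proof (cases "j = k")
          case True
          then show ?thesis using False i zy[OF i] Qk ij by auto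
        next
          case False
          then show ?thesis using \<open>i \<noteq> k\<close> i ij y by auto
        qed
      qed
    qed
  qed
qed

subsection \<open>Points off the arrangement\<close>

text \<open>The index 0 falls into the negative branch and gets the junk value \<open>- x 0\<close>,
  hence the side condition in the sign rule below; 0 is not a signed index.\<close>

definition signed_coord :: "(nat \<Rightarrow> real) \<Rightarrow> int \<Rightarrow> real" where
  "signed_coord x i = (if i > 0 then x (nat i) else - x (nat (- i)))"

fun letter_value :: "(nat \<Rightarrow> real) \<Rightarrow> letter \<Rightarrow> real" where
  "letter_value x (Alpha i s) = signed_coord x i + real s"

lemma signed_coord_minus: "i \<noteq> 0 \<Longrightarrow> signed_coord x (- i) = - signed_coord x i"
  by (auto simp: signed_coord_def)

lemma signed_indices_uminus: "i \<in> signed_indices n \<Longrightarrow> - i \<in> signed_indices n"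
  by (auto simp: signed_indices_def)

lemma signed_indices_nonzero: "i \<in> signed_indices n \<Longrightarrow> i \<noteq> 0"
  by (auto simp: signed_indices_def)

lemma signed_indices_cases:
  assumes "i \<in> signed_indices n"
  obtains k where "1 \<le> k" "k \<le> n" "i = int k" | k where "1 \<le> k" "k \<le> n" "i = - int k"
proof (cases "i > 0")
  case True
  then show thesis using that(1)[of "nat i"] assms by (auto simp: signed_indices_def)
next
  case False
  then show thesis using that(2)[of "nat (- i)"] assms by (auto simp: signed_indices_def)
qed

lemma alphabet_eq: "alphabet n = (\<lambda>(i, s). Alpha i s) ` (signed_indices n \<times> {0, 1})"
  unfolding alphabet_def by auto

lemma finite_alphabet: "finite (alphabet n)"
  unfolding alphabet_eq signed_indices_def by simp

lemma card_alphabet: "card (alphabet n) = 4 * n"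
proof -
  have "card (signed_indices n) = 2 * n"
    unfolding signed_indices_def by (subst card_Diff_singleton) auto
  then show ?thesis
    unfolding alphabet_eq by (subst card_image) (auto simp: inj_on_def card_cartesian_product)
qed

text \<open>\<open>Alpha i s\<close> and \<open>Alpha j t\<close> collide iff the coordinates differ
  by \<open>t - s\<close>, and such differences range exactly over -1, 0, 1. For
  \<open>i = j\<close> a collision forces \<open>s = t\<close>.\<close>

lemma letter_value_inj_iff:
  "inj_on (letter_value x) (alphabet n) \<longleftrightarrow>
    (\<forall>i\<in>signed_indices n. \<forall>j\<in>signed_indices n. i \<noteq> j \<longrightarrow>
      signed_coord x i - signed_coord x j \<notin> {-1, 0, 1})" (is "?L \<longleftrightarrow> ?R")
proof
  assume L: ?L
  show ?R
  proof (intro ballI impI notI)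
    fix i j assume ij: "i \<in> signed_indices n" "j \<in> signed_indices n" "i \<noteq> j"
      and "signed_coord x i - signed_coord x j \<in> {-1, 0, 1}"
    then consider "signed_coord x i + 1 = signed_coord x j"
      | "signed_coord x i = signed_coord x j" | "signed_coord x i = signed_coord x j + 1"
      by (auto simp: algebra_simps)
    then obtain s t :: nat where st: "s \<in> {0, 1}" "t \<in> {0, 1}"
      "letter_value x (Alpha i s) = letter_value x (Alpha j t)"
    proof cases
      case 1
      then show thesis using that[of 1 0] by simp
    next
      case 2
      then show thesis using that[of 0 0] by simp
    next
      case 3
      then show thesis using that[of 0 1] by simp
    qed
    then have "Alpha i s = Alpha j t"
      using ij by (intro inj_onD[OF L]) (auto simp: alphabet_def)
    then show False using ij by simp
  qed
next
  assume R: ?R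
  show ?L
  proof (rule inj_onI)
    fix a b assume "a \<in> alphabet n" "b \<in> alphabet n" and eq: "letter_value x a = letter_value x b"
    then obtain i s j t where ab: "a = Alpha i s" "b = Alpha j t"
      "i \<in> signed_indices n" "j \<in> signed_indices n" "s \<in> {0, 1}" "t \<in> {0, 1}"
      unfolding alphabet_def by blast
    have "signed_coord x i - signed_coord x j \<in> {-1, 0, 1}" using eq ab by auto
    then have "i = j" using R ab by blast
    then show "a = b" using eq ab by auto
  qed
qed

definition off_points :: "nat \<Rightarrow> (nat \<Rightarrow> real) set" where
  "off_points n = topspace (Rn n) - \<Union> (catalan_C n)"

lemma mem_catalan_C_Union_iff:
  assumes "x \<in> topspace (Rn n)"
  shows "x \<in> \<Union> (catalan_C n) \<longleftrightarrow>
    (\<exists>i j. 1 \<le> i \<and> i < j \<and> j \<le> n \<and> (x i - x j \<in> {-1, 0, 1} \<or> x i + x j \<in> {-1, 0, 1})) \<or>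
    (\<exists>i. 1 \<le> i \<and> i \<le> n \<and> 2 * x i \<in> {-1, 0, 1})"
proof -
  \<comment> \<open>Stated for a general \<open>g\<close>, to be used once with subtraction and once
    with addition.\<close>
  have pairs: "x \<in> \<Union> {{x \<in> T. g (x i) (x j) = s} | i j s. 1 \<le> i \<and> i < j \<and> j \<le> n \<and> s \<in> S} \<longleftrightarrow>
      (\<exists>i j. 1 \<le> i \<and> i < j \<and> j \<le> n \<and> g (x i) (x j) \<in> S)"
    if "x \<in> T" for T and S :: "real set" and g :: "real \<Rightarrow> real \<Rightarrow> real"
    unfolding Union_iff Bex_def mem_Collect_eq using that by auto
  have singles: "x \<in> \<Union> {{x \<in> T. 2 * x i = s} | i s. 1 \<le> i \<and> i \<le> n \<and> s \<in> S} \<longleftrightarrow>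
      (\<exists>i. 1 \<le> i \<and> i \<le> n \<and> 2 * x i \<in> S)"
    if "x \<in> T" for T and S :: "real set"
    unfolding Union_iff Bex_def mem_Collect_eq using that by auto
  show ?thesis
    unfolding catalan_C_def Union_Un_distrib Un_iff
      pairs[OF assms, of "\<lambda>a b. a - b"] pairs[OF assms, of "\<lambda>a b. a + b"] singles[OF assms]
    by meson
qed

text \<open>Up to sign, the differences of signed coordinates at distinct indices are exactly
  \<open>x i - x j\<close>, \<open>x i + x j\<close> and \<open>2 * x i\<close>, and the set of
  levels -1, 0, 1 is closed under negation.\<close>

lemma off_points_iff:
  "x \<in> off_points n \<longleftrightarrow> x \<in> topspace (Rn n) \<and> inj_on (letter_value x) (alphabet n)"
proof (cases "x \<in> topspace (Rn n)")
  case x: True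
  have off: "x \<in> off_points n \<longleftrightarrow>
    (\<forall>i j. 1 \<le> i \<and> i < j \<and> j \<le> n \<longrightarrow> x i - x j \<notin> {-1, 0, 1} \<and> x i + x j \<notin> {-1, 0, 1}) \<and>
    (\<forall>i. 1 \<le> i \<and> i \<le> n \<longrightarrow> 2 * x i \<notin> {-1, 0, 1})" (is "_ \<longleftrightarrow> ?O")
    using x mem_catalan_C_Union_iff[OF x] unfolding off_points_def Diff_iff by meson
  have "?O \<longleftrightarrow> (\<forall>i\<in>signed_indices n. \<forall>j\<in>signed_indices n. i \<noteq> j \<longrightarrow>
      signed_coord x i - signed_coord x j \<notin> {-1, 0, 1})" (is "_ \<longleftrightarrow> ?R")
  proof
    assume O: ?O
    have diff: "x k - x l \<notin> {-1, 0, 1}" if "1 \<le> k" "1 \<le> l" "k \<le> n" "l \<le> n" "k \<noteq> l" for k l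
    proof (cases "k < l")
      case False
      then have "x l - x k \<notin> {-1, 0, 1}" using O that by simp
      then show ?thesis by auto
    qed (use O that in blast)
    \<comment> \<open>The case \<open>k = l\<close> covers the hyperplanes
      \<open>2 * x k = s\<close>, which come from the pair of signed indices \<open>k\<close> and
      \<open>- k\<close>.\<close>
    have add: "x k + x l \<notin> {-1, 0, 1}" if "1 \<le> k" "1 \<le> l" "k \<le> n" "l \<le> n" for k l
    proof -
      consider "k < l" | "k = l" | "l < k" by linarith
      then show ?thesis
      proof cases
        case 1
        then show ?thesis using O that by blast
      next
        case 2
        then show ?thesis using O that by (metis mult_2)
      next
        case 3
        then show ?thesis using O that by (metis add.commute)
      qed
    qed
    show ?R
    proof (intro ballI impI)
      fix i j assume ij: "i \<in> signed_indices n" "j \<in> signed_indices n" "i \<noteq> j"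
      from ij(1) show "signed_coord x i - signed_coord x j \<notin> {-1, 0, 1}"
      proof (cases rule: signed_indices_cases)
        case i: (1 k)
        from ij(2) show ?thesis
        proof (cases rule: signed_indices_cases)
          case (1 l)
          then show ?thesis using diff[of k l] i ij(3) by (auto simp: signed_coord_def)
        next
          case (2 l)
          then show ?thesis using add[of k l] i ij(3) by (auto simp: signed_coord_def)
        qed
      next
        case i: (2 k)
        from ij(2) show ?thesis
        proof (cases rule: signed_indices_cases)
          case (1 l)
          then show ?thesis using add[of k l] i ij(3) by (auto simp: signed_coord_def)
        next
          case (2 l)
          then show ?thesis using diff[of k l] i ij(3) by (auto simp: signed_coord_def)
        qed
      qed
    qed
  next
    assume R: ?R
    have pos: "int k \<in> signed_indices n" "- int k \<in> signed_indices n"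
      "signed_coord x (int k) = x k" "signed_coord x (- int k) = - x k"
      if "1 \<le> k" "k \<le> n" for k
      using that by (auto simp: signed_indices_def signed_coord_def)
    show ?O
    proof (intro conjI allI impI)
      fix i j assume ij: "1 \<le> i \<and> i < j \<and> j \<le> n"
      then show "x i - x j \<notin> {-1, 0, 1}"
        using R[rule_format, of "int i" "int j"] pos[of i] pos[of j] by simp
      show "x i + x j \<notin> {-1, 0, 1}"
        using R[rule_format, of "int i" "- int j"] pos[of i] pos[of j] ij by simp
    next
      fix i assume i: "1 \<le> i \<and> i \<le> n"
      show "2 * x i \<notin> {-1, 0, 1}"
        using R[rule_format, of "int i" "- int i"] pos[of i] i by simp
    qed
  qed
  then show ?thesis using x off letter_value_inj_iff[of x n] by simp
qed (simp add: off_points_def)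

subsection \<open>Sketches of points\<close>

definition point_sketch :: "nat \<Rightarrow> (nat \<Rightarrow> real) \<Rightarrow> letter list" where
  "point_sketch n x = key_sorted_list (letter_value x) (alphabet n)"

lemma appears_before_point_sketch:
  assumes "x \<in> off_points n" "a \<in> alphabet n" "b \<in> alphabet n"
  shows "appears_before (point_sketch n x) a b \<longleftrightarrow> letter_value x a < letter_value x b"
proof -
  have inj: "inj_on (letter_value x) (alphabet n)" using assms(1) by (simp add: off_points_iff)
  show ?thesis
    unfolding point_sketch_def using assms(2,3) finite_alphabet inj
    by (intro appears_before_key_sorted sorted_wrt_key_sorted_list) (simp_all add: set_key_sorted_list)
qed

text \<open>Conditions (ii) and (iii) hold because each second letter is its first letter shifted by
  1. Condition (iv) is the equivalence of \<open>a < b + s\<close> and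
  \<open>- b < - a + s\<close>.\<close>

lemma point_sketch_in_sketches:
  assumes "x \<in> off_points n"
  shows "point_sketch n x \<in> symmetric_annotated_1_sketches n"
proof -
  have "inj_on (letter_value x) (alphabet n)" using assms by (simp add: off_points_iff)
  then have 1: "length (point_sketch n x) = 4 * n" "set (point_sketch n x) = alphabet n"
    unfolding point_sketch_def
    by (simp_all add: finite_alphabet length_key_sorted_list set_key_sorted_list card_alphabet)
  have before: "appears_before (point_sketch n x) (Alpha i s) (Alpha j t) \<longleftrightarrow>
      signed_coord x i + real s < signed_coord x j + real t"
    if "i \<in> signed_indices n" "j \<in> signed_indices n" "s \<in> {0, 1}" "t \<in> {0, 1}" for i j s t
  proof -
    have "Alpha i s \<in> alphabet n" "Alpha j t \<in> alphabet n" using that unfolding alphabet_def by blast+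
    then show ?thesis using appears_before_point_sketch[OF assms] by simp
  qed
  show ?thesis
    unfolding symmetric_annotated_1_sketches_def mem_Collect_eq
  proof (intro conjI 1 ballI impI)
    fix i j s assume ij: "i \<in> signed_indices n" "j \<in> signed_indices n" and s: "s \<in> {0, 1::nat}"
      and *: "appears_before (point_sketch n x) (Alpha i 0) (Alpha j s)"
    then show "appears_before (point_sketch n x) (Alpha (- j) 0) (Alpha (- i) s)"
      using before[of i j 0 s] before[of "- j" "- i" 0 s]
      by (auto simp: signed_coord_minus signed_indices_uminus signed_indices_nonzero)
  qed (auto simp: before)
qed

section \<open>Realising every sketch by a point off the arrangement\<close>

lemma ex_point_of_sketch:
  assumes w: "w \<in> symmetric_annotated_1_sketches n"
  shows "\<exists>x\<in>off_points n. point_sketch n x = w"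
proof -
  note w' = w[unfolded symmetric_annotated_1_sketches_def mem_Collect_eq]
  have len: "length w = 4 * n" and set: "set w = alphabet n" using w' by auto
  then have dist: "distinct w" by (metis card_alphabet card_distinct)
  define pos where "pos = the_inv_into {..<length w} ((!) w)"
  have inj: "inj_on ((!) w) {..<length w}" using dist by (simp add: inj_on_nth)
  have pos_nth: "pos (w ! p) = p" if "p < length w" for p
    unfolding pos_def using inj that by (simp add: the_inv_into_f_f)
  have nth_pos: "w ! pos a = a" "pos a < length w" if "a \<in> alphabet n" for a
    using that pos_nth by (metis set in_set_conv_nth)+
  have before: "appears_before w a b \<longleftrightarrow> pos a < pos b" if "a \<in> alphabet n" "b \<in> alphabet n" for a b
    unfolding appears_before_def using that pos_nth nth_pos by (metis less_trans)
  define P where "P i = pos (Alpha i 0)" for i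
  define Q where "Q i = pos (Alpha i 1)" for i
  let ?I = "signed_indices n"
  have alph: "Alpha i s \<in> alphabet n" if "i \<in> ?I" "s \<in> {0, 1}" for i s
    using that by (auto simp: alphabet_def)
  have pos_eq: "a = b" if "a \<in> alphabet n" "b \<in> alphabet n" "pos a = pos b" for a b
    using that nth_pos by metis
  have PQ: "P i < Q i" if "i \<in> ?I" for i
    using w' that alph before unfolding P_def Q_def by simp
  have mono: "Q i < Q j" if "i \<in> ?I" "j \<in> ?I" "P i < P j" for i j
    using w' that alph before unfolding P_def Q_def by simp
  have sym0: "P (- j) < P (- i)" if "i \<in> ?I" "j \<in> ?I" "P i < P j" for i j
    using w' that alph before signed_indices_uminus unfolding P_def by simp
  have sym1: "P (- j) < Q (- i)" if "i \<in> ?I" "j \<in> ?I" "P i < Q j" for i j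
    using w' that alph before signed_indices_uminus unfolding P_def Q_def by simp
  have inj_P: "inj_on P ?I"
    using pos_eq alph unfolding P_def inj_on_def by blast
  have P_neq_Q: "P i \<noteq> Q j" if "i \<in> ?I" "j \<in> ?I" for i j
    using pos_eq[of "Alpha i 0" "Alpha j 1"] alph that unfolding P_def Q_def by auto
  \<comment> \<open>Contrapositive of \<open>sym1\<close> at the negated indices; strictness comes
    from the positions being distinct.\<close>
  have sym1': "Q (- i) < P (- j)" if "i \<in> ?I" "j \<in> ?I" "Q j < P i" for i j
    using sym1[of "- j" "- i"] P_neq_Q[of "- j" "- i"] that signed_indices_uminus
    by (metis add.inverse_inverse less_asym linorder_neqE_nat)
  have "finite ?I" by (simp add: signed_indices_def)
  then obtain y :: "int \<Rightarrow> real" where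
      y0: "\<And>i j. i \<in> ?I \<Longrightarrow> j \<in> ?I \<Longrightarrow> P i < P j \<Longrightarrow> y i < y j" and
      y1: "\<And>i j. i \<in> ?I \<Longrightarrow> j \<in> ?I \<Longrightarrow> P i < Q j \<Longrightarrow> y i < y j + 1" and
      y2: "\<And>i j. i \<in> ?I \<Longrightarrow> j \<in> ?I \<Longrightarrow> Q j < P i \<Longrightarrow> y j + 1 < y i"
    using ex_unit_interval_representation[of ?I P Q, OF _ inj_P PQ mono] by blast
  \<comment> \<open>\<open>x\<close> averages \<open>y\<close> with its reflection
    \<open>\<lambda>i. - y (- i)\<close>. By condition (iv) the reflection satisfies the same strict
    inequalities as \<open>y\<close>, so the average does too, and it obeys the sign rule.\<close>
  define x where "x = (\<lambda>k\<in>{1..n}. (y (int k) - y (- int k)) / 2)"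
  have X: "signed_coord x i = (y i - y (- i)) / 2" if "i \<in> ?I" for i
    using that
    by (cases rule: signed_indices_cases) (auto simp: signed_coord_def x_def diff_divide_distrib)
  have less: "letter_value x a < letter_value x b"
    if ab: "a \<in> alphabet n" "b \<in> alphabet n" "pos a < pos b" for a b
  proof -
    obtain i s j t where eq: "a = Alpha i s" "b = Alpha j t" and
      ij: "i \<in> ?I" "j \<in> ?I" and st: "s \<in> {0, 1}" "t \<in> {0, 1}"
      using ab unfolding alphabet_def by blast
    note ij' = ij[THEN signed_indices_uminus]
    have lt: "signed_coord x i < signed_coord x j" if "P i < P j"
      using y0[OF ij that] y0[OF ij'(2,1) sym0[OF ij that]] by (simp add: X ij)
    consider "s = 0" "t = 0" | "s = 0" "t = 1" | "s = 1" "t = 0" | "s = 1" "t = 1"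
      using st by auto
    then show ?thesis
    proof cases
      case 1
      then show ?thesis using lt ab eq by (simp add: P_def)
    next
      case 2
      then have "P i < Q j" using ab eq by (simp add: P_def Q_def)
      then show ?thesis
        using y1[OF ij] y1[OF ij'(2,1) sym1[OF ij]] 2 eq by (simp add: X ij field_simps)
    next
      case 3
      then have *: "Q i < P j" using ab eq by (simp add: P_def Q_def)
      then show ?thesis
        using y2[OF ij(2,1) *] y2[OF ij' sym1'[OF ij(2,1) *]] 3 eq by (simp add: X ij field_simps)
    next
      case 4
      then have "Q i < Q j" using ab eq by (simp add: Q_def)
      \<comment> \<open>Converse of \<open>mono\<close>: injectivity of \<open>P\<close> makes
        distinct left end points comparable, and \<open>P j < P i\<close> would give
        \<open>Q j < Q i\<close>.\<close>
      then have "P i < P j"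
        using mono[OF ij(2,1)] inj_P ij by (metis inj_onD less_asym less_irrefl linorder_neqE_nat)
      then show ?thesis using lt 4 eq by simp
    qed
  qed
  have "sorted_wrt (<) (map (letter_value x) w)"
    unfolding sorted_wrt_iff_nth_less by (simp add: less pos_nth flip: set)
  \<comment> \<open>Strictly increasing values along \<open>w\<close> yield both claims: the letter
    values are distinct, so \<open>x\<close> is off the arrangement, and \<open>w\<close> is the
    word that sorts them.\<close>
  note unique = key_sorted_list_unique[OF this, unfolded set]
  show ?thesis
  proof
    show "x \<in> off_points n" using unique(2) by (auto simp: off_points_iff x_def)
    show "point_sketch n x = w" using unique(1) by (simp add: point_sketch_def)
  qed
qed

subsection \<open>Regions and sketches\<close>

lemma continuous_map_letter_value:
  assumes "a \<in> alphabet n"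
  shows "continuous_map (Rn n) euclideanreal (\<lambda>x. letter_value x a)"
proof -
  obtain i s where a: "a = Alpha i s" and i: "i \<in> signed_indices n"
    using assms unfolding alphabet_def by blast
  have proj: "continuous_map (Rn n) euclideanreal (\<lambda>x. x k)" if "1 \<le> k" "k \<le> n" for k
    using that by (intro continuous_map_product_projection) simp
  show ?thesis
    using i by (cases rule: signed_indices_cases)
      (auto simp: a signed_coord_def intro!: continuous_intros proj)
qed

text \<open>Intermediate value theorem: if the difference of two letter values changed sign on
  \<open>C\<close>, it would vanish somewhere on \<open>C\<close>, but letter values are distinct
  off the arrangement.\<close>

lemma connectedin_off_points_order:
  assumes C: "connectedin (subtopology (Rn n) (off_points n)) C"
    and xy: "x \<in> C" "y \<in> C" and ab: "a \<in> alphabet n" "b \<in> alphabet n"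
    and less: "letter_value x a < letter_value x b"
  shows "letter_value y a < letter_value y b"
proof (rule ccontr)
  assume not_less: "\<not> letter_value y a < letter_value y b"
  define g where "g z = letter_value z b - letter_value z a" for z
  have "connectedin (Rn n) C" and sub: "C \<subseteq> off_points n"
    using C by (auto simp: connectedin_subtopology)
  moreover have "continuous_map (Rn n) euclideanreal g"
    unfolding g_def by (intro continuous_intros continuous_map_letter_value ab)
  ultimately have "connected (g ` C)"
    using connectedin_continuous_map_image by (metis connectedin_iff_connected)
  moreover have "g x \<in> g ` C" "g y \<in> g ` C" "g y \<le> 0" "0 \<le> g x"
    using xy less not_less by (auto simp: g_def)
  ultimately have "0 \<in> g ` C" by (metis connectedD_interval)
  then obtain z where "z \<in> C" "letter_value z b = letter_value z a" unfolding g_def by auto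
  moreover have "a \<noteq> b" using less by auto
  ultimately show False using sub ab by (metis inj_onD off_points_iff subsetD)
qed

text \<open>The word sorted by the values at \<open>x\<close> is also strictly sorted by those at
  \<open>y\<close>, and such a word on the whole alphabet is unique.\<close>

lemma point_sketch_cong:
  assumes "x \<in> off_points n" "y \<in> off_points n"
    and "\<And>a b. a \<in> alphabet n \<Longrightarrow> b \<in> alphabet n \<Longrightarrow>
      letter_value x a < letter_value x b \<Longrightarrow> letter_value y a < letter_value y b"
  shows "point_sketch n x = point_sketch n y"
proof -
  let ?w = "point_sketch n x"
  have inj: "inj_on (letter_value x) (alphabet n)" using assms by (simp add: off_points_iff)
  then have set: "set ?w = alphabet n"
    by (simp add: point_sketch_def finite_alphabet set_key_sorted_list)
  have "sorted_wrt (<) (map (letter_value x) ?w)"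
    unfolding point_sketch_def using finite_alphabet inj by (rule sorted_wrt_key_sorted_list)
  then have "sorted_wrt (<) (map (letter_value y) ?w)"
    unfolding sorted_wrt_map by (rule sorted_wrt_mono_rel[rotated]) (use assms(3) set in auto)
  from key_sorted_list_unique(1)[OF this, unfolded set] show ?thesis
    by (simp only: point_sketch_def)
qed

text \<open>Letter values are affine in the point, so every strict inequality shared by
  \<open>x\<close> and \<open>y\<close> persists along the segment between them, which therefore
  avoids the arrangement.\<close>

lemma connected_component_of_if_same_sketch:
  assumes x: "x \<in> off_points n" and y: "y \<in> off_points n"
    and eq: "point_sketch n x = point_sketch n y"
  shows "connected_component_of (subtopology (Rn n) (off_points n)) x y"
proof -
  \<comment> \<open>The segment from \<open>x\<close> to \<open>y\<close>, restricted to the index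
    set so that its points are extensional and its ends are \<open>x\<close> and \<open>y\<close>
    themselves.\<close>
  define h where "h t = (\<lambda>k\<in>{1..n}. (1 - t) * x k + t * y k)" for t :: real
  have top: "x \<in> topspace (Rn n)" "y \<in> topspace (Rn n)" using x y by (auto simp: off_points_iff)
  have h_value: "letter_value (h t) a = (1 - t) * letter_value x a + t * letter_value y a"
    if "a \<in> alphabet n" for t a
  proof -
    obtain i s where a: "a = Alpha i s" and i: "i \<in> signed_indices n"
      using \<open>a \<in> alphabet n\<close> unfolding alphabet_def by blast
    show ?thesis
      using i by (cases rule: signed_indices_cases)
        (auto simp: a h_def signed_coord_def algebra_simps)
  qed
  have order: "letter_value x a < letter_value x b \<longleftrightarrow> letter_value y a < letter_value y b"
    if "a \<in> alphabet n" "b \<in> alphabet n" for a b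
    using appears_before_point_sketch[OF x that] appears_before_point_sketch[OF y that] eq by simp
  have h_less: "letter_value (h t) a < letter_value (h t) b"
    if "a \<in> alphabet n" "b \<in> alphabet n" "letter_value x a < letter_value x b" "t \<in> {0..1}" for a b t
  proof -
    have "letter_value y a < letter_value y b" using order that by simp
    then have "0 < (1 - t) * (letter_value x b - letter_value x a)
        + t * (letter_value y b - letter_value y a)"
      \<comment> \<open>The strictly positive summand is the first one for \<open>t = 0\<close> and
        the second one for \<open>t > 0\<close>.\<close>
      using that by (cases "t = 0") (auto intro!: add_nonneg_pos)
    then show ?thesis by (simp add: h_value that algebra_simps)
  qed
  have h_off: "h t \<in> off_points n" if "t \<in> {0..1}" for t
  proof -
    have "inj_on (letter_value (h t)) (alphabet n)"
    proof (rule inj_onI)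
      fix a b assume ab: "a \<in> alphabet n" "b \<in> alphabet n"
        and "letter_value (h t) a = letter_value (h t) b"
      then have "letter_value x a = letter_value x b"
        using h_less[OF ab] h_less[OF ab(2,1)] that by (metis less_irrefl linorder_neqE)
      then show "a = b" using x ab by (metis inj_onD off_points_iff)
    qed
    then show ?thesis by (auto simp: off_points_iff h_def)
  qed
  have "continuous_map euclideanreal (Rn n) h"
    unfolding continuous_map_componentwise h_def
    by (auto intro!: continuous_intros)
  then have "connectedin (Rn n) (h ` {0..1})"
    by (rule connectedin_continuous_map_image) simp
  then have "connectedin (subtopology (Rn n) (off_points n)) (h ` {0..1})"
    using h_off by (auto simp: connectedin_subtopology)
  moreover have "h 0 = x" "h 1 = y"
    using top[unfolded topspace_product_topology, THEN PiE_restrict] by (simp_all add: h_def)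
  then have "x \<in> h ` {0..1}" "y \<in> h ` {0..1}" by force+
  ultimately show ?thesis unfolding connected_component_of_def by blast
qed

section \<open>The bijection between regions and sketches\<close>

theorem proposition1p3:
  fixes n :: nat
  assumes "n \<ge> 1"
  shows "\<exists>f. bij_betw f (regions n (catalan_C n)) (symmetric_annotated_1_sketches n)"
proof -
  let ?X = "subtopology (Rn n) (off_points n)"
  have regions: "regions n (catalan_C n) = connected_components_of ?X"
    by (simp add: regions_def off_points_def)
  have off: "topspace ?X = off_points n" unfolding topspace_subtopology off_points_def by blast
  have same: "point_sketch n x = point_sketch n y"
    if C: "C \<in> connected_components_of ?X" "x \<in> C" "y \<in> C" for C x y
  proof -
    have con: "connectedin ?X C" by (rule connectedin_connected_components_of[OF C(1)])
    have "x \<in> off_points n" "y \<in> off_points n"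
      using C(2,3) connected_components_of_subset[OF C(1)] unfolding off by blast+
    then show ?thesis
      by (rule point_sketch_cong) (rule connectedin_off_points_order[OF con C(2,3)])
  qed
  \<comment> \<open>A region is sent to the sketch of a chosen point in it; by \<open>same\<close>
    the choice does not matter.\<close>
  define f where "f C = point_sketch n (SOME x. x \<in> C)" for C
  have f_eq: "f C = point_sketch n x" if "C \<in> connected_components_of ?X" "x \<in> C" for C x
    unfolding f_def using that(1) _ that(2)
  proof (rule same)
    show "(SOME x. x \<in> C) \<in> C" using that(2) unfolding some_in_eq by blast
  qed
  \<comment> \<open>Each region is the component of one of its own points, so it is nonempty and
    \<open>f_eq\<close> can be applied to it.\<close>
  have component: "\<exists>x\<in>off_points n. C = connected_component_of_set ?X x \<and> x \<in> C"
    if C: "C \<in> connected_components_of ?X" for C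
  proof -
    obtain x where "x \<in> off_points n" "C = connected_component_of_set ?X x"
      using C unfolding connected_components_of_def off by blast
    moreover from this(1) have "connected_component_of ?X x x"
      unfolding connected_component_of_refl off .
    ultimately show ?thesis by blast
  qed
  have "bij_betw f (connected_components_of ?X) (symmetric_annotated_1_sketches n)"
  \<comment> \<open>Injectivity: points with equal sketches lie in one component. Surjectivity: the
    component of a point realising \<open>w\<close> is mapped to \<open>w\<close>.\<close>
  proof (rule bij_betw_imageI[OF inj_onI], goal_cases)
    case CD: (1 C D)
    obtain x y where x: "x \<in> off_points n" "C = connected_component_of_set ?X x" "x \<in> C"
      and y: "y \<in> off_points n" "D = connected_component_of_set ?X y" "y \<in> D"
      using component CD by metis
    have "point_sketch n x = point_sketch n y"
      using f_eq[OF CD(1) x(3)] f_eq[OF CD(2) y(3)] CD(3) by simp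
    then have "connected_component_of ?X x y"
      by (rule connected_component_of_if_same_sketch[OF x(1) y(1)])
    then have "connected_component_of ?X x = connected_component_of ?X y"
      using connected_component_of_equiv by metis
    then show "C = D" by (simp only: x(2) y(2))
  next
    case 2
    show ?case
    proof (intro equalityI subsetI)
      fix w assume "w \<in> f ` connected_components_of ?X"
      then obtain C where C: "C \<in> connected_components_of ?X" "w = f C" by blast
      obtain x where "x \<in> off_points n" "x \<in> C" using component[OF C(1)] by blast
      then show "w \<in> symmetric_annotated_1_sketches n"
        using f_eq[OF C(1)] C(2) point_sketch_in_sketches by simp
    next
      fix w assume "w \<in> symmetric_annotated_1_sketches n"
      then obtain x where x: "x \<in> off_points n" "point_sketch n x = w"
        using ex_point_of_sketch by blast
      let ?C = "connected_component_of_set ?X x"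
      have C: "?C \<in> connected_components_of ?X"
        using x(1) unfolding connected_components_of_def off by blast
      have "x \<in> ?C"
        using x(1) unfolding mem_Collect_eq connected_component_of_refl off .
      then have "w = f ?C" using f_eq[OF C] x(2) by simp
      then show "w \<in> f ` connected_components_of ?X" using C by (rule image_eqI)
    qed
  qed
  then show ?thesis unfolding regions by blast
qed

end
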